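(* Let $p\colon E\to B$ be an arc-hedgehog covering with $E$ a Peano space. Then $p$ is regular if and only if the deck transformation group $DTG(p)$ acts transitively on each fiber of $p$ (i.e., for all $e_1,e_2\in E$ with $p(e_1)=p(e_2)$ there is $h\in DTG(p)$ with $h(e_1)=e_2$).
   Context: All maps are continuous. A Peano space is a connected, locally path-connected space. For a class $\mathcal{P}$ of spaces, a map $p\colon E\to B$ is a $\mathcal{P}$-covering if for every $e_0\in E$, $X\in\mathcal{P}$, $x_0\in X$ and map $f\colon X\to B$ with $f(x_0)=p(e_0)$ there is a unique map $g\colon X\to E$ with $p\circ g=f$ and $g(x_0)=e_0$. A directed wedge is the wedge $(Z,z_0)=\bigvee_{s\in S}(Z_s,z_s)$ of pointed Peano spaces indexed by a directed set $S$, with the topology: $U\subset Z\setminus\{z_0\}$ is open iff each $U\cap Z_s$ is open in $Z_s$; $U\ni z_0$ is an open neighborhood of $z_0$ iff each $U\cap Z_s$ is open and there is $t\in S$ with $Z_s\subset U$ for all $s>t$. An arc-hedgehog is a directed wedge with each $(Z_s,z_s)\cong([0,1],0)$; an arc-hedgehog covering is a $\mathcal{P}$-covering for $\mathcal{P}$ the class of all arc-hedgehogs (it is in particular an arc-covering, i.e., has unique lifts of paths). Such a covering is regular if for every loop $\alpha$ in $B$ either all lifts of $\alpha$ to $E$ are loops or none are. $DTG(p)$ is the group of homeomorphisms $h\colon E\to E$ with $p\circ h=p$. *)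

theory Defs
  imports "HOL-Analysis.Analysis"
begin

definition peano_space :: "'a topology \<Rightarrow> bool" where
  "peano_space X \<longleftrightarrow> connected_space X \<and> locally_path_connected_space X"

definition directed_set :: "'i set \<Rightarrow> ('i \<Rightarrow> 'i \<Rightarrow> bool) \<Rightarrow> bool" where
  "directed_set S le \<longleftrightarrow> S \<noteq> {} \<and> (\<forall>s\<in>S. le s s)
     \<and> (\<forall>r\<in>S. \<forall>s\<in>S. \<forall>t\<in>S. le r s \<and> le s t \<longrightarrow> le r t)
     \<and> (\<forall>s\<in>S. \<forall>t\<in>S. \<exists>u\<in>S. le s u \<and> le t u)"

definition dstrict :: "('i \<Rightarrow> 'i \<Rightarrow> bool) \<Rightarrow> 'i \<Rightarrow> 'i \<Rightarrow> bool" where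
  "dstrict le t s \<longleftrightarrow> le t s \<and> \<not> le s t"

text \<open>Points of the arc-hedgehog: the base point (wedge point) is None; the point at
  parameter x of spine s is Some (s, x) for 0 < x \<le> 1; parameter 0 is the base point.\<close>
definition hh_point :: "'i \<Rightarrow> real \<Rightarrow> ('i \<times> real) option" where
  "hh_point s x = (if x = 0 then None else Some (s, x))"

definition hh_carrier :: "'i set \<Rightarrow> ('i \<times> real) option set" where
  "hh_carrier S = insert None {Some (s, x) | s x. s \<in> S \<and> 0 < x \<and> x \<le> 1}"

text \<open>Open sets of the directed wedge of arcs ([0,1],0) indexed by the directed set (S, le).\<close>
definition hh_open :: "'i set \<Rightarrow> ('i \<Rightarrow> 'i \<Rightarrow> bool) \<Rightarrow> ('i \<times> real) option set \<Rightarrow> bool" where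
  "hh_open S le U \<longleftrightarrow> U \<subseteq> hh_carrier S
     \<and> (\<forall>s\<in>S. openin (top_of_set {0..1::real}) {x \<in> {0..1}. hh_point s x \<in> U})
     \<and> (None \<in> U \<longrightarrow> (\<exists>t\<in>S. \<forall>s\<in>S. dstrict le t s \<longrightarrow> (\<forall>x\<in>{0..1}. hh_point s x \<in> U)))"

lemma istopology_hh_open:
  assumes "directed_set S le"
  shows "istopology (hh_open S le)"
  unfolding istopology_def
proof (intro conjI allI impI)
  fix U V assume U: "hh_open S le U" and V: "hh_open S le V"
  show "hh_open S le (U \<inter> V)"
    unfolding hh_open_def
  proof (intro conjI ballI impI)
    show "U \<inter> V \<subseteq> hh_carrier S" using U unfolding hh_open_def by blast
  next
    fix s assume "s \<in> S"
    have "{x \<in> {0..1}. hh_point s x \<in> U \<inter> V} = {x \<in> {0..1}. hh_point s x \<in> U} \<inter> {x \<in> {0..1}. hh_point s x \<in> V}" by blast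
    moreover have "openin (top_of_set {0..1}) ({x \<in> {0..1}. hh_point s x \<in> U} \<inter> {x \<in> {0..1}. hh_point s x \<in> V})"
      using U V \<open>s\<in>S\<close> unfolding hh_open_def by (intro openin_Int) blast+
    ultimately show "openin (top_of_set {0..1}) {x \<in> {0..1}. hh_point s x \<in> U \<inter> V}" by simp
  next
    assume N: "None \<in> U \<inter> V"
    have "\<exists>t\<in>S. \<forall>s\<in>S. dstrict le t s \<longrightarrow> (\<forall>x\<in>{0..1}. hh_point s x \<in> U)"
      using U N unfolding hh_open_def by simp
    then obtain t1 where t1: "t1\<in>S" "\<forall>s\<in>S. dstrict le t1 s \<longrightarrow> (\<forall>x\<in>{0..1}. hh_point s x \<in> U)" ..
    have "\<exists>t\<in>S. \<forall>s\<in>S. dstrict le t s \<longrightarrow> (\<forall>x\<in>{0..1}. hh_point s x \<in> V)"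
      using V N unfolding hh_open_def by simp
    then obtain t2 where t2: "t2\<in>S" "\<forall>s\<in>S. dstrict le t2 s \<longrightarrow> (\<forall>x\<in>{0..1}. hh_point s x \<in> V)" ..
    have ub: "\<forall>s\<in>S. \<forall>t\<in>S. \<exists>u\<in>S. le s u \<and> le t u"
      using assms unfolding directed_set_def by (elim conjE)
    have "\<exists>u\<in>S. le t1 u \<and> le t2 u" using ub t1(1) t2(1) by blast
    then obtain u where u: "u\<in>S" "le t1 u" "le t2 u" by blast
    have trr: "\<forall>r\<in>S. \<forall>s\<in>S. \<forall>t\<in>S. le r s \<and> le s t \<longrightarrow> le r t"
      using assms unfolding directed_set_def by (elim conjE)
    have tr: "\<And>r s t. r\<in>S \<Longrightarrow> s\<in>S \<Longrightarrow> t\<in>S \<Longrightarrow> le r s \<Longrightarrow> le s t \<Longrightarrow> le r t"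
      using trr by blast
    have st: "dstrict le t1 s \<and> dstrict le t2 s" if "s\<in>S" "dstrict le u s" for s
    proof -
      have "le u s" "\<not> le s u" using that(2) unfolding dstrict_def by auto
      then have "le t1 s" "le t2 s" "\<not> le s t1" "\<not> le s t2"
        using tr[of t1 u s] tr[of t2 u s] tr[of s t1 u] tr[of s t2 u] u t1(1) t2(1) that(1) by blast+
      then show ?thesis unfolding dstrict_def by simp
    qed
    show "\<exists>t\<in>S. \<forall>s\<in>S. dstrict le t s \<longrightarrow> (\<forall>x\<in>{0..1}. hh_point s x \<in> U \<inter> V)"
    proof (intro bexI[of _ u] ballI impI)
      fix s x assume "s\<in>S" "dstrict le u s" "x \<in> {0..1::real}"
      then show "hh_point s x \<in> U \<inter> V" using st t1(2) t2(2) by blast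
    qed (rule u(1))
  qed
next
  fix K assume K: "\<forall>U\<in>K. hh_open S le U"
  show "hh_open S le (\<Union>K)"
    unfolding hh_open_def
  proof (intro conjI ballI impI)
    show "\<Union>K \<subseteq> hh_carrier S" using K unfolding hh_open_def by blast
  next
    fix s assume "s \<in> S"
    have "{x \<in> {0..1}. hh_point s x \<in> \<Union>K} = (\<Union>U\<in>K. {x \<in> {0..1}. hh_point s x \<in> U})" by blast
    moreover have "openin (top_of_set {0..1}) (\<Union>U\<in>K. {x \<in> {0..1}. hh_point s x \<in> U})"
      using K \<open>s\<in>S\<close> unfolding hh_open_def by (intro openin_Union) blast
    ultimately show "openin (top_of_set {0..1}) {x \<in> {0..1}. hh_point s x \<in> \<Union>K}" by simp
  next
    assume "None \<in> \<Union>K"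
    then obtain U where UK: "U\<in>K" "None\<in>U" by blast
    then have "hh_open S le U" using K by blast
    then have "\<exists>t\<in>S. \<forall>s\<in>S. dstrict le t s \<longrightarrow> (\<forall>x\<in>{0..1}. hh_point s x \<in> U)"
      using UK(2) unfolding hh_open_def by simp
    then show "\<exists>t\<in>S. \<forall>s\<in>S. dstrict le t s \<longrightarrow> (\<forall>x\<in>{0..1}. hh_point s x \<in> \<Union>K)"
      using UK(1) by blast
  qed
qed

definition arc_hedgehog :: "'i set \<Rightarrow> ('i \<Rightarrow> 'i \<Rightarrow> bool) \<Rightarrow> ('i \<times> real) option topology" where
  "arc_hedgehog S le = topology (hh_open S le)"

text \<open>Arc-hedgehog covering, for all arc-hedgehogs indexed by directed subsets of the type 'i:
  unique lifting (uniqueness on the carrier) for every based map from an arc-hedgehog.\<close>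
definition arc_hedgehog_covering ::
    "'i itself \<Rightarrow> 'e topology \<Rightarrow> 'b topology \<Rightarrow> ('e \<Rightarrow> 'b) \<Rightarrow> bool" where
  "arc_hedgehog_covering _ E B p \<longleftrightarrow> continuous_map E B p \<and>
     (\<forall>e0 \<in> topspace E. \<forall>(S::'i set) le. directed_set S le \<longrightarrow>
        (\<forall>x0 \<in> topspace (arc_hedgehog S le). \<forall>f.
           continuous_map (arc_hedgehog S le) B f \<and> f x0 = p e0 \<longrightarrow>
           (\<exists>g. continuous_map (arc_hedgehog S le) E g
                \<and> (\<forall>z\<in>topspace (arc_hedgehog S le). p (g z) = f z) \<and> g x0 = e0
                \<and> (\<forall>g'. continuous_map (arc_hedgehog S le) E g'
                        \<and> (\<forall>z\<in>topspace (arc_hedgehog S le). p (g' z) = f z) \<and> g' x0 = e0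
                        \<longrightarrow> (\<forall>z\<in>topspace (arc_hedgehog S le). g' z = g z)))))"

definition is_lift :: "'e topology \<Rightarrow> ('e \<Rightarrow> 'b) \<Rightarrow> (real \<Rightarrow> 'b) \<Rightarrow> (real \<Rightarrow> 'e) \<Rightarrow> bool" where
  "is_lift E p \<alpha> \<beta> \<longleftrightarrow> pathin E \<beta> \<and> (\<forall>t\<in>{0..1}. p (\<beta> t) = \<alpha> t)"

definition regular_covering :: "'e topology \<Rightarrow> 'b topology \<Rightarrow> ('e \<Rightarrow> 'b) \<Rightarrow> bool" where
  "regular_covering E B p \<longleftrightarrow>
     (\<forall>\<alpha>. pathin B \<alpha> \<and> \<alpha> 0 = \<alpha> 1 \<longrightarrow>
        (\<forall>\<beta>. is_lift E p \<alpha> \<beta> \<longrightarrow> \<beta> 0 = \<beta> 1) \<or> (\<forall>\<beta>. is_lift E p \<alpha> \<beta> \<longrightarrow> \<beta> 0 \<noteq> \<beta> 1))"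

definition DTG :: "'e topology \<Rightarrow> ('e \<Rightarrow> 'b) \<Rightarrow> ('e \<Rightarrow> 'e) set" where
  "DTG E p = {h. homeomorphic_map E E h \<and> (\<forall>e\<in>topspace E. p (h e) = p e)}"

end

theory Submission
  imports Defs
begin

text \<open>If the deck group is transitive on fibres, a deck transformation carrying the start of one
  lift of a loop to the start of another carries the first lift onto the second, by uniqueness of
  path lifting; so either both lifts are closed or neither is.

  Conversely, for a and b in one fibre, transport x by following a path from a to x and lifting
  its image from b; regularity makes the endpoint independent of the path, and transport from b
  back to a inverts it. The point is continuity, where hedgehogs replace local simple
  connectedness. If x has a smallest neighbourhood, a path jumping into x at time 1 from any point
  of it shows that transport preserves that neighbourhood relation. Otherwise the open
  neighbourhoods of x form a directed set without maximum, and paths inside ever smaller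
  neighbourhoods assemble to a map on an arc-hedgehog; continuity of its lift at the base point
  forces the transports of their endpoints close to the transport of x.\<close>

section \<open>Arc-hedgehogs\<close>

lemma hh_point_in_carrier: "s \<in> S \<Longrightarrow> x \<in> {0..1} \<Longrightarrow> hh_point s x \<in> hh_carrier S"
  by (auto simp: hh_point_def hh_carrier_def)

lemma hh_open_carrier:
  assumes "directed_set S le"
  shows "hh_open S le (hh_carrier S)"
proof -
  obtain t where "t \<in> S" using assms by (auto simp: directed_set_def)
  moreover have "{x \<in> {0..1}. hh_point s x \<in> hh_carrier S} = {0..1}" if "s \<in> S" for s
    using hh_point_in_carrier[OF that] by auto
  ultimately show ?thesis unfolding hh_open_def using hh_point_in_carrier by auto
qed

lemma openin_arc_hedgehog:
  assumes "directed_set S le"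
  shows "openin (arc_hedgehog S le) = hh_open S le"
  unfolding arc_hedgehog_def using istopology_hh_open[OF assms] by (simp add: topology_inverse')

lemma topspace_arc_hedgehog:
  assumes "directed_set S le"
  shows "topspace (arc_hedgehog S le) = hh_carrier S"
proof -
  have "topspace (arc_hedgehog S le) = \<Union>{U. hh_open S le U}"
    by (simp add: topspace_def openin_arc_hedgehog[OF assms])
  also have "\<dots> = hh_carrier S"
    using hh_open_carrier[OF assms] by (auto simp: hh_open_def)
  finally show ?thesis .
qed

lemma continuous_map_hh_point:
  assumes "directed_set S le" "s \<in> S"
  shows "continuous_map (top_of_set {0..1}) (arc_hedgehog S le) (hh_point s)"
  unfolding continuous_map_def
proof (intro conjI allI impI)
  show "hh_point s \<in> topspace (top_of_set {0..1}) \<rightarrow> topspace (arc_hedgehog S le)"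
    using hh_point_in_carrier[OF assms(2)] by (auto simp: topspace_arc_hedgehog[OF assms(1)])
  fix U assume "openin (arc_hedgehog S le) U"
  then have "hh_open S le U" by (simp add: openin_arc_hedgehog[OF assms(1)])
  then show "openin (top_of_set {0..1}) {x \<in> topspace (top_of_set {0..1}). hh_point s x \<in> U}"
    using assms(2) unfolding hh_open_def by auto
qed

lemma continuous_map_from_arc_hedgehog:
  assumes D: "directed_set S le"
    and top: "\<And>z. z \<in> hh_carrier S \<Longrightarrow> F z \<in> topspace X"
    and spine: "\<And>s. s \<in> S \<Longrightarrow> continuous_map (top_of_set {0..1}) X (F \<circ> hh_point s)"
    and base: "\<And>W. openin X W \<Longrightarrow> F None \<in> W \<Longrightarrow>
               \<exists>t\<in>S. \<forall>s\<in>S. dstrict le t s \<longrightarrow> (\<forall>x\<in>{0..1}. F (hh_point s x) \<in> W)"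
  shows "continuous_map (arc_hedgehog S le) X F"
  unfolding continuous_map_def
proof (intro conjI allI impI)
  show "F \<in> topspace (arc_hedgehog S le) \<rightarrow> topspace X"
    using top by (auto simp: topspace_arc_hedgehog[OF D])
  fix W assume W: "openin X W"
  have "hh_open S le {z \<in> hh_carrier S. F z \<in> W}"
    unfolding hh_open_def
  proof (intro conjI ballI impI)
    show "{z \<in> hh_carrier S. F z \<in> W} \<subseteq> hh_carrier S" by blast
  next
    fix s assume s: "s \<in> S"
    have "{x \<in> {0..1}. hh_point s x \<in> {z \<in> hh_carrier S. F z \<in> W}}
          = {x \<in> topspace (top_of_set {0..1}). (F \<circ> hh_point s) x \<in> W}"
      using hh_point_in_carrier[OF s] by (auto simp del: atLeastAtMost_iff)
    then show "openin (top_of_set {0..1}) {x \<in> {0..1}. hh_point s x \<in> {z \<in> hh_carrier S. F z \<in> W}}"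
      using spine[OF s] W by (simp add: continuous_map_def)
  next
    assume "None \<in> {z \<in> hh_carrier S. F z \<in> W}"
    then obtain t where t: "t \<in> S" "\<forall>s\<in>S. dstrict le t s \<longrightarrow> (\<forall>x\<in>{0..1}. F (hh_point s x) \<in> W)"
      using base[OF W] by blast
    show "\<exists>t\<in>S. \<forall>s\<in>S. dstrict le t s \<longrightarrow> (\<forall>x\<in>{0..1}. hh_point s x \<in> {z \<in> hh_carrier S. F z \<in> W})"
    proof (intro bexI[OF _ t(1)] ballI impI)
      fix s x assume "s \<in> S" "dstrict le t s" "x \<in> {0..1::real}"
      then show "hh_point s x \<in> {z \<in> hh_carrier S. F z \<in> W}"
        using t(2) hh_point_in_carrier[of s S x] by blast
    qed
  qed
  then show "openin (arc_hedgehog S le) {x \<in> topspace (arc_hedgehog S le). F x \<in> W}"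
    by (simp add: openin_arc_hedgehog[OF D] topspace_arc_hedgehog[OF D])
qed

lemma continuous_map_arc_hedgehog_at_base:
  assumes D: "directed_set S le" and G: "continuous_map (arc_hedgehog S le) X G"
    and W: "openin X W" "G None \<in> W"
  shows "\<exists>t\<in>S. \<forall>s\<in>S. dstrict le t s \<longrightarrow> (\<forall>x\<in>{0..1}. G (hh_point s x) \<in> W)"
proof -
  have "openin (arc_hedgehog S le) {z \<in> topspace (arc_hedgehog S le). G z \<in> W}"
    using G W(1) by (simp add: continuous_map_def)
  then have "hh_open S le {z \<in> hh_carrier S. G z \<in> W}"
    by (simp add: openin_arc_hedgehog[OF D] topspace_arc_hedgehog[OF D])
  moreover have "None \<in> hh_carrier S" by (simp add: hh_carrier_def)
  ultimately show ?thesis using W(2) unfolding hh_open_def by blast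
qed

definition hedgehog_map :: "'a \<Rightarrow> ('i \<Rightarrow> real \<Rightarrow> 'a) \<Rightarrow> ('i \<times> real) option \<Rightarrow> 'a" where
  "hedgehog_map x g z = (case z of None \<Rightarrow> x | Some (s, r) \<Rightarrow> g s r)"

lemma hedgehog_map_None [simp]: "hedgehog_map x g None = x"
  by (simp add: hedgehog_map_def)

lemma hedgehog_map_hh_point [simp]: "g s 0 = x \<Longrightarrow> hedgehog_map x g (hh_point s r) = g s r"
  by (simp add: hedgehog_map_def hh_point_def)

lemma continuous_map_hedgehog_map:
  assumes D: "directed_set S le"
    and paths: "\<And>s. s \<in> S \<Longrightarrow> pathin X (g s) \<and> g s 0 = x"
    and base: "\<And>W. openin X W \<Longrightarrow> x \<in> W \<Longrightarrow>
               \<exists>t\<in>S. \<forall>s\<in>S. dstrict le t s \<longrightarrow> g s \<in> {0..1} \<rightarrow> W"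
  shows "continuous_map (arc_hedgehog S le) X (hedgehog_map x g)"
proof (rule continuous_map_from_arc_hedgehog[OF D])
  fix z assume z: "z \<in> hh_carrier S"
  obtain s where "s \<in> S" using D by (auto simp: directed_set_def)
  with z show "hedgehog_map x g z \<in> topspace X"
    using paths path_start_in_topspace path_image_subset_topspace
    by (fastforce simp: hh_carrier_def hedgehog_map_def)
next
  fix s assume s: "s \<in> S"
  have "hedgehog_map x g \<circ> hh_point s = g s" using paths[OF s] by (auto simp: fun_eq_iff)
  then show "continuous_map (top_of_set {0..1}) X (hedgehog_map x g \<circ> hh_point s)"
    using paths[OF s] by (simp add: pathin_def)
next
  fix W assume "openin X W" "hedgehog_map x g None \<in> W"
  then show "\<exists>t\<in>S. \<forall>s\<in>S. dstrict le t s \<longrightarrow> (\<forall>r\<in>{0..1}. hedgehog_map x g (hh_point s r) \<in> W)"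
    using base paths by fastforce
qed

lemma directed_set_singleton: "directed_set {s} (\<lambda>_ _. True)"
  by (simp add: directed_set_def)

lemma directed_set_inv_superset:
  assumes j: "inj j" and N: "N \<noteq> {}" and Int: "\<And>U U'. U \<in> N \<Longrightarrow> U' \<in> N \<Longrightarrow> U \<inter> U' \<in> N"
  shows "directed_set (j ` N) (\<lambda>s t. inv j t \<subseteq> inv j s)"
  unfolding directed_set_def
proof (intro conjI)
  show "\<forall>s\<in>j ` N. \<forall>t\<in>j ` N. \<exists>u\<in>j ` N. inv j u \<subseteq> inv j s \<and> inv j u \<subseteq> inv j t"
  proof (intro ballI)
    fix s t assume "s \<in> j ` N" "t \<in> j ` N"
    then obtain U U' where "U \<in> N" "U' \<in> N" "s = j U" "t = j U'" by blast
    then show "\<exists>u\<in>j ` N. inv j u \<subseteq> inv j s \<and> inv j u \<subseteq> inv j t"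
      using Int j by (intro bexI[of _ "j (U \<inter> U')"]) (auto simp: inv_f_f)
  qed
qed (use N in blast)+

section \<open>Unique path lifting\<close>

lemma arc_hedgehog_covering_continuous:
  "arc_hedgehog_covering TYPE('i) E B p \<Longrightarrow> continuous_map E B p"
  by (simp add: arc_hedgehog_covering_def)

lemma arc_hedgehog_covering_lift:
  fixes S :: "'i set"
  assumes cov: "arc_hedgehog_covering TYPE('i) E B p" and D: "directed_set S le"
    and f: "continuous_map (arc_hedgehog S le) B f"
    and e0: "e0 \<in> topspace E" and f0: "f None = p e0"
  obtains g where "continuous_map (arc_hedgehog S le) E g"
    "\<forall>z\<in>topspace (arc_hedgehog S le). p (g z) = f z" "g None = e0"
proof -
  have "None \<in> topspace (arc_hedgehog S le)"
    by (simp add: topspace_arc_hedgehog[OF D] hh_carrier_def)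
  then show ?thesis
    using cov D f e0 f0 that unfolding arc_hedgehog_covering_def by blast
qed

lemma arc_hedgehog_covering_lift_unique:
  fixes S :: "'i set"
  assumes cov: "arc_hedgehog_covering TYPE('i) E B p" and D: "directed_set S le"
    and g1: "continuous_map (arc_hedgehog S le) E g1"
    and g2: "continuous_map (arc_hedgehog S le) E g2"
    and same_image: "\<forall>z\<in>topspace (arc_hedgehog S le). p (g2 z) = p (g1 z)"
    and same_base: "g1 None = g2 None"
    and z: "z \<in> topspace (arc_hedgehog S le)"
  shows "g1 z = g2 z"
proof -
  have None: "None \<in> topspace (arc_hedgehog S le)"
    by (simp add: topspace_arc_hedgehog[OF D] hh_carrier_def)
  have f: "continuous_map (arc_hedgehog S le) B (p \<circ> g1)"
    using continuous_map_compose[OF g1 arc_hedgehog_covering_continuous[OF cov]] .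
  have e0: "g1 None \<in> topspace E"
    using None g1 by (auto simp: continuous_map_def)
  obtain g where g: "\<forall>g'. continuous_map (arc_hedgehog S le) E g'
        \<and> (\<forall>z\<in>topspace (arc_hedgehog S le). p (g' z) = (p \<circ> g1) z) \<and> g' None = g1 None
        \<longrightarrow> (\<forall>z\<in>topspace (arc_hedgehog S le). g' z = g z)"
    using cov D None f e0 comp_apply[of p g1 None] unfolding arc_hedgehog_covering_def by blast
  have "g1 z = g z" using g g1 z by simp
  moreover have "g2 z = g z" using g g2 z same_image same_base by simp
  ultimately show ?thesis by simp
qed

text \<open>Path lifting is the case of a hedgehog with a single spine.\<close>

lemma path_lift_exists:
  assumes cov: "arc_hedgehog_covering TYPE('i) E B p"
    and \<alpha>: "pathin B \<alpha>" and e0: "e0 \<in> topspace E" and \<alpha>0: "\<alpha> 0 = p e0"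
  obtains \<beta> where "pathin E \<beta>" "\<beta> 0 = e0" "\<forall>t\<in>{0..1}. p (\<beta> t) = \<alpha> t"
proof -
  define s :: 'i where "s = undefined"
  let ?H = "arc_hedgehog {s} (\<lambda>_ _. True)"
  have f: "continuous_map ?H B (hedgehog_map (\<alpha> 0) (\<lambda>_. \<alpha>))"
    using \<alpha> by (intro continuous_map_hedgehog_map[OF directed_set_singleton]) (auto simp: dstrict_def)
  obtain g where g: "continuous_map ?H E g"
    "\<forall>z\<in>topspace ?H. p (g z) = hedgehog_map (\<alpha> 0) (\<lambda>_. \<alpha>) z" "g None = e0"
    using arc_hedgehog_covering_lift[OF cov directed_set_singleton f e0] \<alpha>0 by auto
  show ?thesis
  proof
    show "pathin E (g \<circ> hh_point s)"
      unfolding pathin_def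
      by (rule continuous_map_compose[OF continuous_map_hh_point[OF directed_set_singleton] g(1)]) simp
    show "(g \<circ> hh_point s) 0 = e0" using g(3) by (simp add: hh_point_def)
    show "\<forall>t\<in>{0..1}. p ((g \<circ> hh_point s) t) = \<alpha> t"
      using g(2) hh_point_in_carrier[of s "{s}"]
      by (simp add: topspace_arc_hedgehog[OF directed_set_singleton])
  qed
qed

lemma path_lift_unique:
  assumes cov: "arc_hedgehog_covering TYPE('i) E B p"
    and \<beta>1: "pathin E \<beta>1" and \<beta>2: "pathin E \<beta>2" and start: "\<beta>1 0 = \<beta>2 0"
    and same_image: "\<forall>t\<in>{0..1}. p (\<beta>1 t) = p (\<beta>2 t)"
    and t: "t \<in> {0..1}"
  shows "\<beta>1 t = \<beta>2 t"
proof -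
  define s :: 'i where "s = undefined"
  let ?H = "arc_hedgehog {s} (\<lambda>_ _. True)"
  have g: "continuous_map ?H E (hedgehog_map (\<beta> 0) (\<lambda>_. \<beta>))" if "pathin E \<beta>" for \<beta>
    using that by (intro continuous_map_hedgehog_map[OF directed_set_singleton]) (auto simp: dstrict_def)
  have same: "\<forall>z\<in>topspace ?H. p (hedgehog_map (\<beta>2 0) (\<lambda>_. \<beta>2) z) = p (hedgehog_map (\<beta>1 0) (\<lambda>_. \<beta>1) z)"
    using same_image start
    by (auto simp: topspace_arc_hedgehog[OF directed_set_singleton] hh_carrier_def hedgehog_map_def)
  have "hh_point s t \<in> topspace ?H"
    using hh_point_in_carrier[of s "{s}"] t by (simp add: topspace_arc_hedgehog[OF directed_set_singleton])
  from arc_hedgehog_covering_lift_unique[OF cov directed_set_singleton g[OF \<beta>1] g[OF \<beta>2] same _ this]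
  show ?thesis using start by simp
qed

definition path_join :: "(real \<Rightarrow> 'a) \<Rightarrow> (real \<Rightarrow> 'a) \<Rightarrow> real \<Rightarrow> 'a" where
  "path_join g1 g2 = (\<lambda>x. if x \<le> 1/2 then g1 (2 * x) else g2 (2 * x - 1))"

lemma path_join_0 [simp]: "path_join g1 g2 0 = g1 0"
  by (simp add: path_join_def)

lemma path_join_1 [simp]: "path_join g1 g2 1 = g2 1"
  by (simp add: path_join_def)

lemma pathin_path_join:
  assumes "pathin X g1" "pathin X g2" "g2 0 = g1 1"
  shows "pathin X (path_join g1 g2)"
proof -
  let ?T01 = "top_of_set {0..1::real}"
  have g1: "continuous_map ?T01 X g1" and g2: "continuous_map ?T01 X g2"
    using assms by (auto simp: pathin_def)
  let ?g = "\<lambda>x. if x \<le> 1/2 then (g1 \<circ> (\<lambda>t. 2 * t)) x else (g2 \<circ> (\<lambda>t. 2 * t -1)) x"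
  have "continuous_map ?T01 X ?g"
  proof (intro continuous_map_cases_le continuous_map_compose, force, force)
    show "continuous_map (subtopology ?T01 {x \<in> topspace ?T01. x \<le> 1/2}) ?T01 ((*) 2)"
      by (auto simp: continuous_map_in_subtopology continuous_map_from_subtopology)
    have "continuous_map (subtopology ?T01 {x. 0 \<le> x \<and> x \<le> 1 \<and> 1 \<le> x * 2})
           euclideanreal (\<lambda>t. 2 * t - 1)"
      by (intro continuous_intros) (force intro: continuous_map_from_subtopology)
    then show "continuous_map (subtopology ?T01 {x \<in> topspace ?T01. 1/2 \<le> x}) ?T01 (\<lambda>t. 2 * t - 1)"
      by (force simp: continuous_map_in_subtopology)
    show "(g1 \<circ> (*) 2) x = (g2 \<circ> (\<lambda>t. 2 * t - 1)) x" if "x \<in> topspace ?T01" "x = 1/2" for x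
      using that by (simp add: assms(3) mult.commute)
  qed (auto simp: g1 g2)
  moreover have "?g = path_join g1 g2" by (simp add: path_join_def fun_eq_iff)
  ultimately show ?thesis by (simp add: pathin_def)
qed

lemma pathin_affine_reparam:
  assumes "pathin X g" and ab: "\<And>t. t \<in> {0..1} \<Longrightarrow> a * t + b \<in> {0..1::real}"
  shows "pathin X (\<lambda>t. g (a * t + b))"
proof -
  have "continuous_map (top_of_set {0..1}) euclideanreal (\<lambda>t. a * t + b)"
    by (simp add: continuous_intros)
  then have "continuous_map (top_of_set {0..1}) (top_of_set {0..1}) (\<lambda>t. a * t + b)"
    using ab by (auto simp: continuous_map_in_subtopology)
  from continuous_map_compose[OF this] assms(1) show ?thesis
    by (simp add: pathin_def o_def)
qed

lemma pathin_jump: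
  assumes x: "x \<in> topspace X" and y: "y \<in> topspace X"
    and spec: "\<And>W. openin X W \<Longrightarrow> x \<in> W \<Longrightarrow> y \<in> W"
  shows "pathin X (\<lambda>t. if t < 1 then y else x)"
proof -
  define c where "c = (\<lambda>t::real. if t < 1 then y else x)"
  have "pathin X c"
    unfolding pathin_def continuous_map_def
  proof (intro conjI allI impI)
    show "c \<in> topspace (top_of_set {0..1}) \<rightarrow> topspace X" using x y by (auto simp: c_def)
    fix W assume W: "openin X W"
    show "openin (top_of_set {0..1}) {t \<in> topspace (top_of_set {0..1}). c t \<in> W}"
    proof (cases "x \<in> W")
      case True
      then have "{t \<in> topspace (top_of_set {0..1}). c t \<in> W} = topspace (top_of_set {0..1::real})"
        using spec[OF W] by (auto simp: c_def)
      then show ?thesis by (metis openin_topspace)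
    next
      case False
      show ?thesis
      proof (cases "y \<in> W")
        case True
        then have "{t \<in> topspace (top_of_set {0..1}). c t \<in> W} = {0..1::real} \<inter> {..<1}"
          using False by (auto simp: c_def)
        then show ?thesis by (simp add: openin_open_Int)
      next
        case False2: False
        then have "{t \<in> topspace (top_of_set {0..1}). c t \<in> W} = {}"
          using False by (auto simp: c_def)
        then show ?thesis by (metis openin_empty)
      qed
    qed
  qed
  then show ?thesis by (simp add: c_def)
qed

section \<open>Transport along paths\<close>

definition transport_pair ::
    "'e topology \<Rightarrow> ('e \<Rightarrow> 'b) \<Rightarrow> 'e \<Rightarrow> 'e \<Rightarrow> 'e \<Rightarrow> (real \<Rightarrow> 'e) \<Rightarrow> (real \<Rightarrow> 'e) \<Rightarrow> bool" where
  "transport_pair E p a b x \<gamma> \<beta> \<longleftrightarrow> pathin E \<gamma> \<and> \<gamma> 0 = a \<and> \<gamma> 1 = x \<and> pathin E \<beta> \<and> \<beta> 0 = b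
      \<and> (\<forall>t\<in>{0..1}. p (\<beta> t) = p (\<gamma> t))"

text \<open>To transport x, follow a path from a to x and lift its image starting at b; the transport
  of x is the endpoint of that lift. Regularity makes it independent of the choices.\<close>

definition transport :: "'e topology \<Rightarrow> ('e \<Rightarrow> 'b) \<Rightarrow> 'e \<Rightarrow> 'e \<Rightarrow> 'e \<Rightarrow> 'e" where
  "transport E p a b x = (SOME y. \<exists>\<gamma> \<beta>. transport_pair E p a b x \<gamma> \<beta> \<and> \<beta> 1 = y)"

definition lifting_compatible :: "'e topology \<Rightarrow> ('e \<Rightarrow> 'b) \<Rightarrow> ('e \<Rightarrow> 'e) \<Rightarrow> bool" where
  "lifting_compatible E p h \<longleftrightarrow> (\<forall>y\<in>topspace E. h y \<in> topspace E \<and> p (h y) = p y) \<and>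
     (\<forall>\<gamma> \<beta>. pathin E \<gamma> \<and> pathin E \<beta> \<and> \<beta> 0 = h (\<gamma> 0) \<and> (\<forall>t\<in>{0..1}. p (\<beta> t) = p (\<gamma> t))
        \<longrightarrow> h (\<gamma> 1) = \<beta> 1)"

lemma lifting_compatible_fibre:
  "lifting_compatible E p h \<Longrightarrow> y \<in> topspace E \<Longrightarrow> h y \<in> topspace E \<and> p (h y) = p y"
  by (simp add: lifting_compatible_def)

lemma lifting_compatible_endpoint:
  assumes "lifting_compatible E p h" "pathin E \<gamma>" "pathin E \<beta>" "\<beta> 0 = h (\<gamma> 0)"
    "\<forall>t\<in>{0..1}. p (\<beta> t) = p (\<gamma> t)"
  shows "h (\<gamma> 1) = \<beta> 1"
  using assms unfolding lifting_compatible_def by blast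

context
  fixes E :: "'e topology" and B :: "'b topology" and p :: "'e \<Rightarrow> 'b"
  assumes cov: "arc_hedgehog_covering TYPE('i) E B p"
begin

lemma regular_transport_pair_endpoint:
  assumes reg: "regular_covering E B p" and b: "b \<in> topspace E" and pab: "p a = p b"
    and P: "transport_pair E p a b x \<gamma> \<beta>" and P': "transport_pair E p a b x \<gamma>' \<beta>'"
  shows "\<beta> 1 = \<beta>' 1"
proof -
  have \<gamma>: "pathin E \<gamma>" "\<gamma> 0 = a" "\<gamma> 1 = x" and \<beta>: "pathin E \<beta>" "\<beta> 0 = b"
    and p\<beta>: "\<forall>t\<in>{0..1}. p (\<beta> t) = p (\<gamma> t)"
    using P by (auto simp: transport_pair_def)
  have \<gamma>': "pathin E \<gamma>'" "\<gamma>' 0 = a" "\<gamma>' 1 = x" and \<beta>': "pathin E \<beta>'" "\<beta>' 0 = b"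
    and p\<beta>': "\<forall>t\<in>{0..1}. p (\<beta>' t) = p (\<gamma>' t)"
    using P' by (auto simp: transport_pair_def)
  define \<delta> where "\<delta> = path_join \<gamma> (\<lambda>t. \<gamma>' ((-1) * t + 1))"
  have \<delta>: "pathin E \<delta>" unfolding \<delta>_def
    by (rule pathin_path_join[OF \<gamma>(1) pathin_affine_reparam[OF \<gamma>'(1)]]) (auto simp: \<gamma> \<gamma>')
  have \<delta>01: "\<delta> 0 = a" "\<delta> 1 = a" by (simp_all add: \<delta>_def \<gamma> \<gamma>')
  define \<alpha> where "\<alpha> = p \<circ> \<delta>"
  have \<alpha>: "pathin B \<alpha>"
    unfolding \<alpha>_def by (rule pathin_compose[OF \<delta> arc_hedgehog_covering_continuous[OF cov]])
  have "\<alpha> 0 = \<alpha> 1" by (simp add: \<alpha>_def \<delta>01)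
  then have "(\<forall>L. is_lift E p \<alpha> L \<longrightarrow> L 0 = L 1) \<or> (\<forall>L. is_lift E p \<alpha> L \<longrightarrow> L 0 \<noteq> L 1)"
    using reg \<alpha> unfolding regular_covering_def by blast
  moreover have "is_lift E p \<alpha> \<delta>" by (simp add: is_lift_def \<delta> \<alpha>_def)
  ultimately have closed: "\<forall>L. is_lift E p \<alpha> L \<longrightarrow> L 0 = L 1" using \<delta>01 by auto
  obtain L where L: "pathin E L" "L 0 = b" "\<forall>t\<in>{0..1}. p (L t) = \<alpha> t"
    using path_lift_exists[OF cov \<alpha> b] \<delta>01 pab \<alpha>_def by auto
  have L01: "L 0 = L 1" using closed L unfolding is_lift_def by blast
  txt \<open>The first half of L lifts \<gamma> from b, the reversed second half lifts \<gamma>' from b.\<close>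
  have "L ((1/2) * 1 + 0) = \<beta> 1"
  proof (rule path_lift_unique[OF cov pathin_affine_reparam[OF L(1)] \<beta>(1)])
    show "\<forall>t\<in>{0..1}. p (L ((1/2) * t + 0)) = p (\<beta> t)"
      using L(3) p\<beta> by (simp add: \<alpha>_def \<delta>_def path_join_def)
  qed (auto simp: L \<beta>)
  moreover have "L ((-1/2) * 1 + 1) = \<beta>' 1"
  proof (rule path_lift_unique[OF cov pathin_affine_reparam[OF L(1)] \<beta>'(1)])
    show "\<forall>t\<in>{0..1}. p (L ((-1/2) * t + 1)) = p (\<beta>' t)"
    proof
      fix t :: real assume t: "t \<in> {0..1}"
      then have "p (L ((-1/2) * t + 1)) = \<alpha> (1 - t/2)" using L(3) by simp
      also have "\<dots> = p (\<gamma>' t)"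
      proof (cases "t = 1")
        case True then show ?thesis by (simp add: \<alpha>_def \<delta>_def path_join_def \<gamma> \<gamma>')
      next
        case False
        then have "\<not> 1 - t/2 \<le> 1/2" using t by auto
        moreover have "-1 * (2 * (1 - t / 2) - 1) + 1 = t" by (simp add: algebra_simps)
        ultimately show ?thesis by (simp add: \<alpha>_def \<delta>_def path_join_def)
      qed
      finally show "p (L ((-1/2) * t + 1)) = p (\<beta>' t)" using p\<beta>' t by simp
    qed
  qed (auto simp: L \<beta>' L01[symmetric])
  ultimately show ?thesis by simp
qed

lemma transport_pair_exists:
  assumes PC: "path_connected_space E" and a: "a \<in> topspace E" and b: "b \<in> topspace E"
    and pab: "p a = p b" and x: "x \<in> topspace E"
  obtains \<gamma> \<beta> where "transport_pair E p a b x \<gamma> \<beta>"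
proof -
  obtain \<gamma> where \<gamma>: "pathin E \<gamma>" "\<gamma> 0 = a" "\<gamma> 1 = x"
    using PC a x unfolding path_connected_space_def by blast
  obtain \<beta> where "pathin E \<beta>" "\<beta> 0 = b" "\<forall>t\<in>{0..1}. p (\<beta> t) = (p \<circ> \<gamma>) t"
    using path_lift_exists[OF cov pathin_compose[OF \<gamma>(1) arc_hedgehog_covering_continuous[OF cov]] b]
      \<gamma> pab by auto
  then show ?thesis using \<gamma> that unfolding transport_pair_def by auto
qed

lemma transport_eq:
  assumes reg: "regular_covering E B p" and b: "b \<in> topspace E" and pab: "p a = p b"
    and P: "transport_pair E p a b x \<gamma> \<beta>"
  shows "transport E p a b x = \<beta> 1"
proof -
  have "\<exists>y \<gamma> \<beta>. transport_pair E p a b x \<gamma> \<beta> \<and> \<beta> 1 = y" using P by blast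
  from someI_ex[OF this] obtain \<gamma>' \<beta>' where
    "transport_pair E p a b x \<gamma>' \<beta>'" "\<beta>' 1 = transport E p a b x"
    unfolding transport_def by blast
  then show ?thesis using regular_transport_pair_endpoint[OF reg b pab P] by metis
qed

lemma transport_start:
  assumes reg: "regular_covering E B p" and a: "a \<in> topspace E" and b: "b \<in> topspace E"
    and pab: "p a = p b"
  shows "transport E p a b a = b"
  using transport_eq[OF reg b pab, of a "\<lambda>_. a" "\<lambda>_. b"] a b pab by (simp add: transport_pair_def)

lemma transport_inverse:
  assumes reg: "regular_covering E B p" and PC: "path_connected_space E"
    and a: "a \<in> topspace E" and b: "b \<in> topspace E" and pab: "p a = p b"
    and x: "x \<in> topspace E"
  shows "transport E p b a (transport E p a b x) = x"
proof -
  obtain \<gamma> \<beta> where P: "transport_pair E p a b x \<gamma> \<beta>" using transport_pair_exists[OF PC a b pab x] .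
  then have "transport_pair E p b a (\<beta> 1) \<beta> \<gamma>" by (auto simp: transport_pair_def)
  from transport_eq[OF reg a pab[symmetric] this] transport_eq[OF reg b pab P] P
  show ?thesis by (simp add: transport_pair_def)
qed

lemma lifting_compatible_transport:
  assumes reg: "regular_covering E B p" and PC: "path_connected_space E"
    and a: "a \<in> topspace E" and b: "b \<in> topspace E" and pab: "p a = p b"
  shows "lifting_compatible E p (transport E p a b)"
  unfolding lifting_compatible_def
proof (intro conjI ballI allI impI)
  fix x assume x: "x \<in> topspace E"
  obtain \<gamma> \<beta> where P: "transport_pair E p a b x \<gamma> \<beta>" using transport_pair_exists[OF PC a b pab x] .
  then show "transport E p a b x \<in> topspace E" "p (transport E p a b x) = p x"
    using transport_eq[OF reg b pab P] path_finish_in_topspace by (auto simp: transport_pair_def)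
next
  fix \<gamma> \<beta>
  assume "pathin E \<gamma> \<and> pathin E \<beta> \<and> \<beta> 0 = transport E p a b (\<gamma> 0) \<and> (\<forall>t\<in>{0..1}. p (\<beta> t) = p (\<gamma> t))"
  then have \<gamma>: "pathin E \<gamma>" and \<beta>: "pathin E \<beta>" "\<beta> 0 = transport E p a b (\<gamma> 0)"
    and p\<beta>: "\<forall>t\<in>{0..1}. p (\<beta> t) = p (\<gamma> t)" by auto
  obtain \<gamma>0 \<beta>0 where P: "transport_pair E p a b (\<gamma> 0) \<gamma>0 \<beta>0"
    using transport_pair_exists[OF PC a b pab path_start_in_topspace[OF \<gamma>]] .
  have P0: "pathin E \<gamma>0" "\<gamma>0 0 = a" "\<gamma>0 1 = \<gamma> 0" "pathin E \<beta>0" "\<beta>0 0 = b"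
    "\<forall>t\<in>{0..1}. p (\<beta>0 t) = p (\<gamma>0 t)" using P by (auto simp: transport_pair_def)
  have "transport_pair E p a b (\<gamma> 1) (path_join \<gamma>0 \<gamma>) (path_join \<beta>0 \<beta>)"
    unfolding transport_pair_def
  proof (intro conjI ballI)
    show "pathin E (path_join \<gamma>0 \<gamma>)" by (rule pathin_path_join[OF P0(1) \<gamma>]) (simp add: P0)
    show "pathin E (path_join \<beta>0 \<beta>)"
      by (rule pathin_path_join[OF P0(4) \<beta>(1)]) (simp add: \<beta> transport_eq[OF reg b pab P])
    fix t :: real assume t: "t \<in> {0..1}"
    show "p (path_join \<beta>0 \<beta> t) = p (path_join \<gamma>0 \<gamma> t)"
    proof (cases "t \<le> 1/2")
      case True
      then have "2 * t \<in> {0..1}" using t by auto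
      then show ?thesis using True P0(6) by (simp add: path_join_def)
    next
      case False
      then have "2 * t - 1 \<in> {0..1}" using t by auto
      then show ?thesis using False p\<beta> by (simp add: path_join_def)
    qed
  qed (simp_all add: P0)
  from transport_eq[OF reg b pab this] show "transport E p a b (\<gamma> 1) = \<beta> 1" by simp
qed

section \<open>Continuity of lifting-compatible maps\<close>

text \<open>A lift of the jump path from y to x stays at h y before time 1 and ends at h x, so by
  continuity of the lift at time 1, h y lies in every open set containing h x.\<close>

lemma lifting_compatible_specialization:
  assumes h: "lifting_compatible E p h"
    and x: "x \<in> topspace E" and y: "y \<in> topspace E"
    and spec: "\<And>W. openin E W \<Longrightarrow> x \<in> W \<Longrightarrow> y \<in> W"
    and V: "openin E V" "h x \<in> V"
  shows "h y \<in> V"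
proof -
  define c where "c = (\<lambda>t::real. if t < 1 then y else x)"
  have c: "pathin E c" unfolding c_def by (rule pathin_jump[OF x y spec])
  have hy: "h y \<in> topspace E" "p (h y) = p y" using lifting_compatible_fibre[OF h y] by auto
  obtain \<beta> where \<beta>: "pathin E \<beta>" "\<beta> 0 = h y" "\<forall>t\<in>{0..1}. p (\<beta> t) = (p \<circ> c) t"
    using path_lift_exists[OF cov pathin_compose[OF c arc_hedgehog_covering_continuous[OF cov]] hy(1)]
      hy(2) by (auto simp: c_def)
  have "h x = \<beta> 1"
    using lifting_compatible_endpoint[OF h c \<beta>(1)] \<beta>(2,3) by (simp add: c_def)
  have "openin (top_of_set {0..1}) {t \<in> topspace (top_of_set {0..1}). \<beta> t \<in> V}"
    using \<beta>(1) V(1) by (simp add: pathin_def continuous_map_def)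
  then have op: "openin (top_of_set {0..1}) {t \<in> {0..1::real}. \<beta> t \<in> V}" by simp
  have "(1::real) \<in> {t \<in> {0..1::real}. \<beta> t \<in> V}" using V(2) \<open>h x = \<beta> 1\<close> by simp
  then obtain e where e: "e > 0" "\<And>t. t \<in> {0..1} \<Longrightarrow> dist t 1 < e \<Longrightarrow> t \<in> {t \<in> {0..1::real}. \<beta> t \<in> V}"
    using op unfolding openin_euclidean_subtopology_iff by blast
  define t0 where "t0 = max 0 (1 - e/2)"
  have t0: "t0 \<in> {0..1}" "t0 < 1" "dist t0 1 < e" using e(1) by (auto simp: t0_def dist_real_def)
  have "pathin E (\<lambda>s. \<beta> (t0 * s + 0))"
    by (rule pathin_affine_reparam[OF \<beta>(1)]) (use t0 in \<open>auto simp: mult_le_one\<close>)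
  moreover have "\<forall>s\<in>{0..1}. p (\<beta> (t0 * s + 0)) = p y"
  proof
    fix s :: real assume s: "s \<in> {0..1}"
    have "t0 * s \<in> {0..1}" "t0 * s < 1"
      using s t0 by (auto simp: mult_le_one) (metis le_less_trans mult_left_le mult.commute)
    then show "p (\<beta> (t0 * s + 0)) = p y" using \<beta>(3) by (simp add: c_def)
  qed
  ultimately have "h y = \<beta> t0"
    using lifting_compatible_endpoint[OF h, of "\<lambda>_. y" "\<lambda>s. \<beta> (t0 * s + 0)"] y \<beta>(2) by simp
  then show ?thesis using e(2)[OF t0(1) t0(3)] by simp
qed

text \<open>If x has no smallest neighbourhood, the open neighbourhoods of x, indexed in 'i, form a
  directed set without maximum. Paths escaping from transport along every neighbourhood would
  assemble to a map on the corresponding arc-hedgehog whose lift is discontinuous at the base point.\<close>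

lemma lifting_compatible_path_nbhd:
  assumes big: "\<exists>j :: 'e set \<Rightarrow> 'i. inj j" and h: "lifting_compatible E p h"
    and x: "x \<in> topspace E" and V: "openin E V" "h x \<in> V"
    and no_min: "\<And>U. openin E U \<Longrightarrow> x \<in> U \<Longrightarrow> \<exists>W. openin E W \<and> x \<in> W \<and> \<not> U \<subseteq> W"
  shows "\<exists>U. openin E U \<and> x \<in> U \<and>
           (\<forall>\<gamma>. pathin E \<gamma> \<and> \<gamma> 0 = x \<and> (\<forall>t\<in>{0..1}. \<gamma> t \<in> U) \<longrightarrow> h (\<gamma> 1) \<in> V)"
proof (rule ccontr)
  define N where "N = {U. openin E U \<and> x \<in> U}"
  assume "\<not> ?thesis"
  then have "\<forall>U\<in>N. \<exists>\<gamma>. pathin E \<gamma> \<and> \<gamma> 0 = x \<and> (\<forall>t\<in>{0..1}. \<gamma> t \<in> U) \<and> h (\<gamma> 1) \<notin> V"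
    by (auto simp: N_def)
  then obtain g where g: "\<And>U. U \<in> N \<Longrightarrow>
      pathin E (g U) \<and> g U 0 = x \<and> (\<forall>t\<in>{0..1}. g U t \<in> U) \<and> h (g U 1) \<notin> V"
    by metis
  obtain j :: "'e set \<Rightarrow> 'i" where j: "inj j" using big by blast
  have ij: "\<And>U. inv j (j U) = U" using j by (simp add: inv_f_f)
  define le where "le = (\<lambda>s t. inv j t \<subseteq> inv j s)"
  have D: "directed_set (j ` N) le"
    unfolding le_def by (rule directed_set_inv_superset[OF j]) (use x in \<open>auto simp: N_def\<close>)
  define F where "F = hedgehog_map x (\<lambda>s. g (inv j s))"
  have F: "continuous_map (arc_hedgehog (j ` N) le) E F"
    unfolding F_def
  proof (rule continuous_map_hedgehog_map[OF D])
    show "pathin E (g (inv j s)) \<and> g (inv j s) 0 = x" if "s \<in> j ` N" for s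
      using that g by (auto simp: ij)
    fix W assume "openin E W" "x \<in> W"
    then have W: "W \<in> N" by (simp add: N_def)
    show "\<exists>t\<in>j ` N. \<forall>s\<in>j ` N. dstrict le t s \<longrightarrow> g (inv j s) \<in> {0..1} \<rightarrow> W"
    proof (intro bexI[of _ "j W"] ballI impI)
      fix s assume s: "s \<in> j ` N" "dstrict le (j W) s"
      then have "inv j s \<subseteq> W" by (simp add: dstrict_def le_def ij)
      then show "g (inv j s) \<in> {0..1} \<rightarrow> W" using g[of "inv j s"] s(1) by (auto simp: ij)
    qed (use W in blast)
  qed
  have hx: "h x \<in> topspace E" "p (h x) = p x" using lifting_compatible_fibre[OF h x] by auto
  obtain G where G: "continuous_map (arc_hedgehog (j ` N) le) E G"
    "\<forall>z\<in>topspace (arc_hedgehog (j ` N) le). p (G z) = (p \<circ> F) z" "G None = h x"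
    using arc_hedgehog_covering_lift[OF cov D
        continuous_map_compose[OF F arc_hedgehog_covering_continuous[OF cov]] hx(1)] hx(2)
    by (auto simp: F_def)
  obtain t where t: "t \<in> j ` N" "\<forall>s\<in>j ` N. dstrict le t s \<longrightarrow> (\<forall>r\<in>{0..1}. G (hh_point s r) \<in> V)"
    using continuous_map_arc_hedgehog_at_base[OF D G(1) V(1)] G(3) V(2) by auto
  then obtain T where T: "T \<in> N" "t = j T" by blast
  obtain W where W: "openin E W" "x \<in> W" "\<not> T \<subseteq> W" using no_min T(1) by (auto simp: N_def)
  define s where "s = j (T \<inter> W)"
  have s: "s \<in> j ` N" "inv j s = T \<inter> W" using T(1) W by (auto simp: N_def s_def ij)
  have "dstrict le t s" using W(3) by (auto simp: dstrict_def le_def T(2) s(2) ij)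
  then have GV: "G (hh_point s 1) \<in> V" using t(2) s(1) by auto
  have gs: "pathin E (g (inv j s))" "g (inv j s) 0 = x" "h (g (inv j s) 1) \<notin> V"
    using g[of "inv j s"] s by (auto simp: ij)
  have "h (g (inv j s) 1) = (G \<circ> hh_point s) 1"
  proof (rule lifting_compatible_endpoint[OF h gs(1)])
    show "pathin E (G \<circ> hh_point s)"
      unfolding pathin_def by (rule continuous_map_compose[OF continuous_map_hh_point[OF D s(1)] G(1)])
    show "(G \<circ> hh_point s) 0 = h (g (inv j s) 0)" using G(3) gs(2) by (simp add: hh_point_def)
    show "\<forall>r\<in>{0..1}. p ((G \<circ> hh_point s) r) = p (g (inv j s) r)"
    proof
      fix r :: real assume "r \<in> {0..1}"
      then have "hh_point s r \<in> topspace (arc_hedgehog (j ` N) le)"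
        using hh_point_in_carrier[OF s(1)] by (simp add: topspace_arc_hedgehog[OF D])
      then show "p ((G \<circ> hh_point s) r) = p (g (inv j s) r)"
        using G(2) gs(2) by (simp add: F_def)
    qed
  qed
  then show False using GV gs(3) by simp
qed

lemma continuous_map_lifting_compatible:
  assumes big: "\<exists>j :: 'e set \<Rightarrow> 'i. inj j" and lpc: "locally_path_connected_space E"
    and h: "lifting_compatible E p h"
  shows "continuous_map E E h"
  unfolding continuous_map_def
proof (intro conjI allI impI)
  show "h \<in> topspace E \<rightarrow> topspace E" using lifting_compatible_fibre[OF h] by blast
  fix V assume V: "openin E V"
  show "openin E {x \<in> topspace E. h x \<in> V}"
  proof (subst openin_subopen, intro ballI)
    fix x assume "x \<in> {x \<in> topspace E. h x \<in> V}"
    then have x: "x \<in> topspace E" and hx: "h x \<in> V" by auto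
    have "\<exists>T. openin E T \<and> x \<in> T \<and> (\<forall>y\<in>T. h y \<in> V)"
    proof (cases "\<exists>U0. openin E U0 \<and> x \<in> U0 \<and> (\<forall>W. openin E W \<and> x \<in> W \<longrightarrow> U0 \<subseteq> W)")
      case True
      then obtain U0 where U0: "openin E U0" "x \<in> U0" "\<And>W. openin E W \<Longrightarrow> x \<in> W \<Longrightarrow> U0 \<subseteq> W"
        by blast
      have "h y \<in> V" if y: "y \<in> U0" for y
      proof (rule lifting_compatible_specialization[OF h x _ _ V hx])
        show "y \<in> topspace E" using openin_subset[OF U0(1)] y by blast
        show "\<And>W. openin E W \<Longrightarrow> x \<in> W \<Longrightarrow> y \<in> W" using U0(3) y by blast
      qed
      with U0(1,2) show ?thesis by blast
    next
      case False
      then have no_min: "\<And>U. openin E U \<Longrightarrow> x \<in> U \<Longrightarrow> \<exists>W. openin E W \<and> x \<in> W \<and> \<not> U \<subseteq> W"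
        by blast
      obtain U where U: "openin E U" "x \<in> U"
        and escape: "\<And>\<gamma>. pathin E \<gamma> \<Longrightarrow> \<gamma> 0 = x \<Longrightarrow> \<forall>t\<in>{0..1}. \<gamma> t \<in> U \<Longrightarrow> h (\<gamma> 1) \<in> V"
        using lifting_compatible_path_nbhd[OF big h x V hx no_min] by blast
      obtain W where W: "openin E W" "path_connectedin E W" "x \<in> W" "W \<subseteq> U"
        using lpc U unfolding locally_path_connected_space by blast
      have "h y \<in> V" if y: "y \<in> W" for y
      proof -
        obtain \<gamma> where \<gamma>: "pathin E \<gamma>" "\<gamma> \<in> {0..1} \<rightarrow> W" "\<gamma> 0 = x" "\<gamma> 1 = y"
          using W(2,3) y unfolding path_connectedin by blast
        have "\<forall>t\<in>{0..1}. \<gamma> t \<in> U" using \<gamma>(2) W(4) by blast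
        with escape[OF \<gamma>(1,3)] \<gamma>(4) show ?thesis by simp
      qed
      with W(1,3) show ?thesis by blast
    qed
    then show "\<exists>T. openin E T \<and> x \<in> T \<and> T \<subseteq> {x \<in> topspace E. h x \<in> V}"
      using openin_subset by blast
  qed
qed

lemma regular_imp_deck_transitive:
  assumes big: "\<exists>j :: 'e set \<Rightarrow> 'i. inj j" and reg: "regular_covering E B p"
    and peano: "peano_space E"
    and e1: "e1 \<in> topspace E" and e2: "e2 \<in> topspace E" and pe: "p e1 = p e2"
  shows "\<exists>h\<in>DTG E p. h e1 = e2"
proof
  have lpc: "locally_path_connected_space E" using peano by (simp add: peano_space_def)
  then have PC: "path_connected_space E"
    using peano path_connected_eq_connected_space by (auto simp: peano_space_def)
  have compat12: "lifting_compatible E p (transport E p e1 e2)"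
    and compat21: "lifting_compatible E p (transport E p e2 e1)"
    using lifting_compatible_transport[OF reg PC] e1 e2 pe by auto
  have "homeomorphic_maps E E (transport E p e1 e2) (transport E p e2 e1)"
    unfolding homeomorphic_maps_def
    using continuous_map_lifting_compatible[OF big lpc] compat12 compat21
      transport_inverse[OF reg PC e1 e2 pe] transport_inverse[OF reg PC e2 e1 pe[symmetric]] by blast
  then show "transport E p e1 e2 \<in> DTG E p"
    using compat12 homeomorphic_map_maps by (auto simp: DTG_def lifting_compatible_def)
  show "transport E p e1 e2 e1 = e2" by (rule transport_start[OF reg e1 e2 pe])
qed

lemma deck_transitive_imp_regular:
  assumes trans: "\<forall>e1\<in>topspace E. \<forall>e2\<in>topspace E. p e1 = p e2 \<longrightarrow> (\<exists>h\<in>DTG E p. h e1 = e2)"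
  shows "regular_covering E B p"
  unfolding regular_covering_def
proof (intro allI impI)
  fix \<alpha> :: "real \<Rightarrow> 'b"
  show "(\<forall>\<beta>. is_lift E p \<alpha> \<beta> \<longrightarrow> \<beta> 0 = \<beta> 1) \<or> (\<forall>\<beta>. is_lift E p \<alpha> \<beta> \<longrightarrow> \<beta> 0 \<noteq> \<beta> 1)"
  proof (rule ccontr)
    assume "\<not> ?thesis"
    then obtain \<beta>1 \<beta>2 where \<beta>1: "pathin E \<beta>1" "\<forall>t\<in>{0..1}. p (\<beta>1 t) = \<alpha> t" "\<beta>1 0 = \<beta>1 1"
      and \<beta>2: "pathin E \<beta>2" "\<forall>t\<in>{0..1}. p (\<beta>2 t) = \<alpha> t" "\<beta>2 0 \<noteq> \<beta>2 1"
      by (auto simp: is_lift_def)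
    obtain h where h: "h \<in> DTG E p" "h (\<beta>1 0) = \<beta>2 0"
      using trans path_start_in_topspace[OF \<beta>1(1)] path_start_in_topspace[OF \<beta>2(1)] \<beta>1(2) \<beta>2(2) by force
    have hc: "continuous_map E E h" and hp: "\<forall>e\<in>topspace E. p (h e) = p e"
      using h(1) homeomorphic_imp_continuous_map by (auto simp: DTG_def)
    have "(h \<circ> \<beta>1) 1 = \<beta>2 1"
    proof (rule path_lift_unique[OF cov pathin_compose[OF \<beta>1(1) hc] \<beta>2(1)])
      show "\<forall>t\<in>{0..1}. p ((h \<circ> \<beta>1) t) = p (\<beta>2 t)"
      proof
        fix t :: real assume t: "t \<in> {0..1}"
        then have "\<beta>1 t \<in> topspace E" using path_image_subset_topspace[OF \<beta>1(1)] by blast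
        then show "p ((h \<circ> \<beta>1) t) = p (\<beta>2 t)" using hp \<beta>1(2) \<beta>2(2) t by simp
      qed
    qed (use h(2) in auto)
    then show False using \<beta>1(3) \<beta>2(3) h(2) by simp
  qed
qed

end

theorem theorem3p9:
  fixes E :: "'e topology" and B :: "'b topology" and p :: "'e \<Rightarrow> 'b"
  assumes big: "\<exists>j :: 'e set \<Rightarrow> 'i. inj j"
    and cov: "arc_hedgehog_covering TYPE('i) E B p"
    and peano: "peano_space E"
  shows "regular_covering E B p \<longleftrightarrow>
         (\<forall>e1\<in>topspace E. \<forall>e2\<in>topspace E. p e1 = p e2 \<longrightarrow> (\<exists>h\<in>DTG E p. h e1 = e2))"
  using regular_imp_deck_transitive[OF cov big _ peano] deck_transitive_imp_regular[OF cov] by blast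

end
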